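(* For every three-dimensional triangulation $\mathcal{T}_h$ without hanging nodes, with shape regularity constant $c_0 = \max_{T\in\mathcal{T}_h} h_T/\rho_T$, there exists a constant $c_1>0$ depending only on $c_0$ such that its Worsey-Farin refinement $\mathcal{T}_h^{wf}$ satisfies $$\max_{K\in\mathcal{T}_h^{wf}} \frac{h_K}{\rho_K}\le c_1 .$$ (That $c_1$ depends only on $c_0$ means: there is a function $C$ with positive real values such that, for every such triangulation $\mathcal{T}_h$, the bound holds with $c_1=C(c_0)$.)
   Context: $\mathcal{T}_h$ is a finite set of nondegenerate closed tetrahedra in $\mathbb{R}^3$ without hanging nodes (i.e. any two distinct tetrahedra intersect in the empty set, a common vertex, a common edge or a common face); $\Omega$ denotes the domain it triangulates. For a tetrahedron $T$, $\Delta_m(T)$ is the set of its $m$-dimensional simplices ($\Delta_2(T)$: four faces, $\Delta_1(T)$: six edges), $h_T=\operatorname{diam}(T)$, $\rho_T$ is the diameter of the inscribed sphere of $T$ (the largest sphere contained in $T$), and the incenter $z_T$ is the center of that sphere. $[a,b,\dots]$ denotes the convex hull of the listed points. Worsey-Farin refinement $\mathcal{T}_h^{wf}$ of $\mathcal{T}_h$: (1) Connect the incenter $z_T$ of each tetrahedron $T\in\mathcal{T}_h$ to its four vertices. (2) For each interior face $F=T_1\cap T_2$ with $T_1,T_2\in\mathcal{T}_h$, let the split point $m_F$ be the intersection of $F$ with the line segment $[z_{T_1},z_{T_2}]$ (it is known that this segment intersects the common face, so $m_F$ is well defined); for each boundary face $F$ (a face contained in $\partial\Omega$, belonging to exactly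 one $T\in\mathcal{T}_h$), let $m_F$ be the barycenter of $F$. Connect $m_F$ to the three vertices of $F$ and to the incenters $z_{T_1}$ and $z_{T_2}$ (or to $z_T$ for a boundary face). This divides each $T\in\mathcal{T}_h$ into 12 subtetrahedra, namely the tetrahedra $[a,b,m_F,z_T]$ with $F\in\Delta_2(T)$ and $[a,b]$ an edge of $F$; $\mathcal{T}_h^{wf}$ is the set of all these subtetrahedra over all $T\in\mathcal{T}_h$. *)

theory Defs
  imports "HOL-Analysis.Analysis"
begin

text \<open>
  Intersections in the library's \<^const>\<open>triangulation\<close> are common faces, so for distinct
  tetrahedra they are empty, a vertex, an edge or a triangular face.
\<close>

definition tetrahedral_mesh :: "(real^3) set set \<Rightarrow> bool" where
  "tetrahedral_mesh \<T> \<longleftrightarrow> triangulation \<T> \<and> \<T> \<noteq> {} \<and> (\<forall>T\<in>\<T>. 3 simplex T)"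

definition inradius :: "(real^3) set \<Rightarrow> real" where
  "inradius T = Sup {r. 0 \<le> r \<and> (\<exists>z. sphere z r \<subseteq> T)}"

definition incenter :: "(real^3) set \<Rightarrow> real^3" where
  "incenter T = (THE z. sphere z (inradius T) \<subseteq> T)"

definition shape_ratio :: "(real^3) set \<Rightarrow> real" where
  "shape_ratio T = diameter T / (2 * inradius T)"

definition shape_regularity :: "(real^3) set set \<Rightarrow> real" where
  "shape_regularity \<T> = Max (shape_ratio ` \<T>)"

definition triangle_barycenter :: "(real^3) set \<Rightarrow> real^3" where
  "triangle_barycenter F = (1/3) *\<^sub>R (\<Sum>v | v extreme_point_of F. v)"

definition interior_face :: "(real^3) set set \<Rightarrow> (real^3) set \<Rightarrow> bool" where
  "interior_face \<T> F \<longleftrightarrow>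
     (\<exists>T1\<in>\<T>. \<exists>T2\<in>\<T>. T1 \<noteq> T2 \<and> F = T1 \<inter> T2 \<and> F facet_of T1 \<and> F facet_of T2)"

text \<open>
  The tetrahedra \<open>T1\<close>, \<open>T2\<close> sharing a face are determined by it up to order. A facet of a mesh
  element that is not interior belongs to exactly one element, i.e. it is a boundary face.
\<close>

definition split_point :: "(real^3) set set \<Rightarrow> (real^3) set \<Rightarrow> real^3" where
  "split_point \<T> F =
     (if interior_face \<T> F
      then (THE m. \<exists>T1\<in>\<T>. \<exists>T2\<in>\<T>. T1 \<noteq> T2 \<and> F = T1 \<inter> T2 \<and>
                     m \<in> F \<inter> closed_segment (incenter T1) (incenter T2))
      else triangle_barycenter F)"

definition worsey_farin :: "(real^3) set set \<Rightarrow> (real^3) set set" where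
  "worsey_farin \<T> =
     {convex hull {a, b, split_point \<T> F, incenter T} | a b F T.
        T \<in> \<T> \<and> F facet_of T \<and> closed_segment a b edge_of F}"

end

theory Submission
  imports Defs
begin

text \<open>
  Everything is measured by the single number \<open>r / h\<close>, the inradius of an element of the mesh over
  its diameter, which is at least \<open>1 / (2 c)\<close> when all shape ratios are at most \<open>c\<close>. A subtetrahedron
  \<open>[a, b, m, z]\<close> of \<open>T = [a, b, e, d]\<close>, with \<open>m\<close> the split point of the face \<open>[a, b, e]\<close> and \<open>z\<close> the
  incenter of \<open>T\<close>, is well shaped as soon as \<open>z\<close> is not too close to the face and \<open>m\<close> is not too close
  to the edges of the face. Both distances are expressed by barycentric coordinates: if the
  coordinate of \<open>z\<close> at \<open>d\<close> is at least \<open>s\<close> and all coordinates of \<open>m\<close> in the face are at least \<open>t\<close>, then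
  the ball of radius \<open>r / (4 (1 + 1/s) (1 + 1/t))\<close> about the centroid of the subtetrahedron lies inside
  it (\<open>subtetrahedron_contains_sphere\<close>).

  The incenter has the barycentric coordinates \<open>r |g\<^sub>v|\<close>, where \<open>g\<^sub>v\<close> is the gradient of the coordinate
  at \<open>v\<close>; since \<open>|g\<^sub>v| \<ge> 1 / h\<close>, one may take \<open>s = r / h\<close>.

  For the split point, the point \<open>p\<close> at which the insphere touches a face has all its coordinates in
  that face at least \<open>2 (r / h)\<^sup>3\<close>: otherwise some dihedral angle would be close to \<open>\<pi>\<close>, and the
  tetrahedron too flat for its insphere (\<open>tangent_point_deep\<close>). Two elements sharing a face lie on
  opposite sides of it, so their incenters are \<open>p + r n\<close> and \<open>p' - r' n\<close> with one common unit normal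
  \<open>n\<close>. Hence the segment between the incenters crosses the plane of the face at a convex combination
  of the two touching points \<open>p\<close> and \<open>p'\<close>, and this gives the existence of the split point and the
  same lower bound for its coordinates (\<open>incenter_segment_meets_facet\<close>). A boundary face is split at
  its barycenter, whose coordinates are \<open>1/3\<close>.
\<close>

section \<open>Barycentric coordinates of a full-dimensional simplex\<close>

text \<open>
  For the vertex set \<open>V\<close> of a full-dimensional simplex this is the gradient of the affine function that
  is 1 at \<open>v\<close> and 0 at the other vertices. Writing the
  coordinate as an inner product with this vector lets Cauchy-Schwarz turn distances into bounds on
  coordinates.
\<close>

definition bary_grad :: "'a::euclidean_space set \<Rightarrow> 'a \<Rightarrow> 'a" where
  "bary_grad V v = (SOME g. \<forall>w\<in>V - {v}. g \<bullet> (w - v) = - 1)"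

definition bary :: "'a::euclidean_space set \<Rightarrow> 'a \<Rightarrow> 'a \<Rightarrow> real" where
  "bary V v x = 1 + bary_grad V v \<bullet> (x - v)"

lemma bary_diff: "bary V v x - bary V v y = bary_grad V v \<bullet> (x - y)"
  by (simp add: bary_def inner_diff_right)

lemma bary_add: "bary V v (x + y) = bary V v x + bary_grad V v \<bullet> y"
  by (simp add: bary_def inner_diff_right inner_add_right)

lemma bary_affine_combination:
  assumes "(\<Sum>i\<in>I. u i) = 1"
  shows "bary V v (\<Sum>i\<in>I. u i *\<^sub>R p i) = (\<Sum>i\<in>I. u i * bary V v (p i))"
proof -
  have "(\<Sum>i\<in>I. u i * bary V v (p i))
      = (\<Sum>i\<in>I. u i * (1 - bary_grad V v \<bullet> v)) + (\<Sum>i\<in>I. u i * (bary_grad V v \<bullet> p i))"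
    by (simp add: bary_def inner_diff_right algebra_simps sum.distrib sum_subtractf)
  also have "(\<Sum>i\<in>I. u i * (1 - bary_grad V v \<bullet> v)) = 1 - bary_grad V v \<bullet> v"
    using assms by (simp flip: sum_distrib_right)
  finally show ?thesis
    by (simp add: bary_def inner_diff_right inner_sum_right)
qed

lemma bary_affine_combination_2:
  assumes "u + w = 1"
  shows "bary V v (u *\<^sub>R x + w *\<^sub>R y) = u * bary V v x + w * bary V v y"
proof -
  have w: "w = 1 - u" using assms by simp
  show ?thesis
    unfolding bary_def w by (simp add: inner_diff_right inner_add_right algebra_simps)
qed

lemma bary_self [simp]: "bary V v v = 1"
  by (simp add: bary_def)

locale full_simplex =
  fixes V :: "'a::euclidean_space set"
  assumes indep: "\<not> affine_dependent V"
    and card_V: "card V = Suc DIM('a)"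
begin

lemma finite_V [simp]: "finite V"
  using indep by (rule aff_independent_finite)

lemma V_nonempty: "V \<noteq> {}"
  using card_V by auto

text \<open>
  Affine independence makes the edge vectors at \<open>v\<close> linearly independent, so a linear functional can be
  prescribed on them; the adjoint represents it by a vector.
\<close>

lemma bary_other:
  assumes "v \<in> V" "w \<in> V" "w \<noteq> v"
  shows "bary V v w = 0"
proof -
  have "independent ((\<lambda>x. - v + x) ` (V - {v}))"
    using affine_dependent_iff_dependent2[OF assms(1)] indep by blast
  then obtain f :: "'a \<Rightarrow> real" where f: "linear f"
    "\<And>x. x \<in> (\<lambda>x. - v + x) ` (V - {v}) \<Longrightarrow> f x = - 1"
    using linear_independent_extend[of "(\<lambda>x. - v + x) ` (V - {v})" "\<lambda>_. - 1"] by blast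
  have "\<forall>w\<in>V - {v}. adjoint f 1 \<bullet> (w - v) = - 1"
  proof
    fix w assume "w \<in> V - {v}"
    then have "f (w - v) = - 1" by (intro f(2)) (auto intro!: image_eqI[of _ _ w])
    then show "adjoint f 1 \<bullet> (w - v) = - 1"
      using adjoint_works[OF f(1), of "w - v" 1] by (simp add: inner_commute)
  qed
  then have "\<forall>w\<in>V - {v}. bary_grad V v \<bullet> (w - v) = - 1"
    unfolding bary_grad_def by (rule someI)
  with assms show ?thesis by (simp add: bary_def)
qed

lemma bary_vertex: "v \<in> V \<Longrightarrow> w \<in> V \<Longrightarrow> bary V v w = of_bool (w = v)"
  using bary_other by auto

lemma bary_combination:
  assumes "v \<in> V" "(\<Sum>w\<in>V. u w) = 1"
  shows "bary V v (\<Sum>w\<in>V. u w *\<^sub>R w) = u v"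
proof -
  have "bary V v (\<Sum>w\<in>V. u w *\<^sub>R w) = (\<Sum>w\<in>V. u w * of_bool (w = v))"
    using assms by (simp add: bary_affine_combination bary_vertex)
  also have "\<dots> = u v" using assms by simp
  finally show ?thesis .
qed

lemma sum_bary_vertices:
  shows sum_bary: "(\<Sum>v\<in>V. bary V v x) = 1"
    and bary_expansion: "(\<Sum>v\<in>V. bary V v x *\<^sub>R v) = x"
proof -
  have "x \<in> affine hull V"
    using affine_independent_span_eq[OF indep card_V] by simp
  then obtain u where u: "sum u V = 1" "(\<Sum>v\<in>V. u v *\<^sub>R v) = x"
    by (auto simp: affine_hull_finite)
  have "bary V v x = u v" if "v \<in> V" for v
    using bary_combination[OF that u(1)] u(2) by simp
  then show "(\<Sum>v\<in>V. bary V v x) = 1" "(\<Sum>v\<in>V. bary V v x *\<^sub>R v) = x"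
    using u by simp_all
qed

lemma mem_convex_hull_iff: "x \<in> convex hull V \<longleftrightarrow> (\<forall>v\<in>V. 0 \<le> bary V v x)"
proof
  assume "x \<in> convex hull V"
  then obtain u where u: "\<forall>v\<in>V. 0 \<le> u v" "sum u V = 1" "(\<Sum>v\<in>V. u v *\<^sub>R v) = x"
    by (auto simp: convex_hull_finite)
  then show "\<forall>v\<in>V. 0 \<le> bary V v x"
    using bary_combination[OF _ u(2)] by auto
next
  assume "\<forall>v\<in>V. 0 \<le> bary V v x"
  then show "x \<in> convex hull V"
    using sum_bary[of x] bary_expansion[of x]
    by (auto simp: convex_hull_finite intro!: exI[of _ "\<lambda>v. bary V v x"])
qed

lemma bary_nonneg: "x \<in> convex hull V \<Longrightarrow> v \<in> V \<Longrightarrow> 0 \<le> bary V v x"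
  by (simp add: mem_convex_hull_iff)

lemma bary_le_1:
  assumes "x \<in> convex hull V" "v \<in> V" shows "bary V v x \<le> 1"
  using member_le_sum[of v V "\<lambda>v. bary V v x"] assms bary_nonneg sum_bary[of x] by auto

lemma ex_other_vertex: "\<exists>w\<in>V. w \<noteq> v"
proof (rule ccontr)
  assume "\<not> ?thesis"
  then have "V \<subseteq> {v}" by auto
  then have "card V \<le> 1" by (metis card_mono card.empty card_insert_if One_nat_def finite.simps empty_iff)
  then show False using card_V DIM_positive[where 'a='a] by linarith
qed

lemma bary_grad_nonzero: "v \<in> V \<Longrightarrow> bary_grad V v \<noteq> 0"
  using ex_other_vertex[of v] bary_other[of v] by (auto simp: bary_def)

lemma bounded_hull: "bounded (convex hull V)"
  using finite_imp_bounded bounded_convex_hull finite_V by blast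

text \<open>
  The coordinate at \<open>v\<close> rises from 0 to 1 along any edge ending in \<open>v\<close>, and no edge is longer than the
  diameter.
\<close>

lemma one_le_grad_diameter:
  assumes "v \<in> V" shows "1 \<le> norm (bary_grad V v) * diameter (convex hull V)"
proof -
  obtain w where w: "w \<in> V" "w \<noteq> v" using ex_other_vertex by blast
  have "1 = bary_grad V v \<bullet> (v - w)"
    using bary_diff[of V v v w] bary_other[OF assms w] by simp
  also have "\<dots> \<le> norm (bary_grad V v) * norm (v - w)" by (rule norm_cauchy_schwarz)
  also have "norm (v - w) \<le> diameter (convex hull V)"
    using diameter_bounded_bound[OF bounded_hull, of v w] assms w by (simp add: dist_norm hull_inc)
  finally show ?thesis by (simp add: mult_left_mono)
qed

lemma diameter_pos: "0 < diameter (convex hull V)"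
proof -
  obtain v where "v \<in> V" using V_nonempty by blast
  from one_le_grad_diameter[OF this] show ?thesis
    by (smt (verit) norm_ge_zero mult_nonneg_nonpos)
qed

text \<open>
  The lowest value of the coordinate at \<open>v\<close> on the sphere is attained where the radius points against
  the gradient, and it is \<open>r * norm (bary_grad V v)\<close> below the value at the center.
\<close>

lemma sphere_subset_iff:
  assumes "0 \<le> r"
  shows "sphere z r \<subseteq> convex hull V \<longleftrightarrow> (\<forall>v\<in>V. r * norm (bary_grad V v) \<le> bary V v z)"
proof
  assume *: "sphere z r \<subseteq> convex hull V"
  show "\<forall>v\<in>V. r * norm (bary_grad V v) \<le> bary V v z"
  proof
    fix v assume v: "v \<in> V"
    define g where "g = bary_grad V v"
    have g: "g \<noteq> 0" using bary_grad_nonzero[OF v] by (simp add: g_def)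
    have "z - (r / norm g) *\<^sub>R g \<in> sphere z r" using g assms by (simp add: dist_norm)
    then have "0 \<le> bary V v (z - (r / norm g) *\<^sub>R g)" using * v bary_nonneg by blast
    also have "\<dots> = bary V v z - r / norm g * (g \<bullet> g)"
      by (simp add: bary_def g_def inner_diff_right)
    also have "r / norm g * (g \<bullet> g) = r * norm g"
      using g by (simp add: dot_square_norm power2_eq_square)
    finally show "r * norm (bary_grad V v) \<le> bary V v z" by (simp add: g_def)
  qed
next
  assume *: "\<forall>v\<in>V. r * norm (bary_grad V v) \<le> bary V v z"
  show "sphere z r \<subseteq> convex hull V"
  proof
    fix x assume "x \<in> sphere z r"
    then have x: "norm (z - x) = r" by (simp add: dist_norm)
    have "0 \<le> bary V v x" if v: "v \<in> V" for v
    proof -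
      have "bary V v z - bary V v x \<le> norm (bary_grad V v) * norm (z - x)"
        unfolding bary_diff by (rule norm_cauchy_schwarz)
      with x * v show ?thesis by (simp add: mult.commute) (smt (verit))
    qed
    then show "x \<in> convex hull V" by (simp add: mem_convex_hull_iff)
  qed
qed

end

section \<open>The inscribed sphere of a tetrahedron\<close>

locale tetrahedron = full_simplex V for V :: "(real^3) set"
begin

abbreviation "grad_sum \<equiv> \<Sum>v\<in>V. norm (bary_grad V v)"

lemma grad_sum_pos: "0 < grad_sum"
  using V_nonempty bary_grad_nonzero by (intro sum_pos) auto

lemma ex_equidistant_point:
  "\<exists>z. \<forall>v\<in>V. bary V v z = norm (bary_grad V v) / grad_sum"
proof -
  have "(\<Sum>v\<in>V. norm (bary_grad V v) / grad_sum) = 1"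
    using grad_sum_pos by (simp flip: sum_divide_distrib)
  from bary_combination[OF _ this] show ?thesis by blast
qed

text \<open>
  Adding the conditions of \<open>sphere_subset_iff\<close> over the vertices bounds the radius, because the
  coordinates add up to 1; the point whose coordinates are proportional to the gradient lengths
  attains the bound.
\<close>

lemma inradius_eq: "inradius (convex hull V) = 1 / grad_sum"
  unfolding inradius_def
proof (rule cSup_eq_maximum)
  obtain z where "\<forall>v\<in>V. bary V v z = norm (bary_grad V v) / grad_sum"
    using ex_equidistant_point by blast
  then show "1 / grad_sum \<in> {r. 0 \<le> r \<and> (\<exists>z. sphere z r \<subseteq> convex hull V)}"
    using grad_sum_pos by (auto simp: sphere_subset_iff intro!: exI[of _ z])
next
  fix r assume "r \<in> {r. 0 \<le> r \<and> (\<exists>z. sphere z r \<subseteq> convex hull V)}"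
  then obtain z where "\<forall>v\<in>V. r * norm (bary_grad V v) \<le> bary V v z"
    by (auto simp: sphere_subset_iff)
  then have "(\<Sum>v\<in>V. r * norm (bary_grad V v)) \<le> (\<Sum>v\<in>V. bary V v z)" by (intro sum_mono) auto
  then have "r * grad_sum \<le> 1" by (simp add: sum_bary sum_distrib_left)
  then show "r \<le> 1 / grad_sum" using grad_sum_pos by (simp add: pos_le_divide_eq)
qed

lemma inradius_pos: "0 < inradius (convex hull V)"
  using grad_sum_pos by (simp add: inradius_eq)

text \<open>
  At the largest radius the conditions of \<open>sphere_subset_iff\<close> add up to an equality, so each of them is
  an equality. That determines all coordinates of the center, hence the center is unique.
\<close>

lemma bary_incenter:
  assumes "v \<in> V"
  shows "bary V v (incenter (convex hull V)) = inradius (convex hull V) * norm (bary_grad V v)"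
proof -
  let ?r = "inradius (convex hull V)"
  have iff: "sphere z ?r \<subseteq> convex hull V \<longleftrightarrow> (\<forall>v\<in>V. bary V v z = ?r * norm (bary_grad V v))" for z
  proof
    assume "sphere z ?r \<subseteq> convex hull V"
    then have le: "\<And>v. v \<in> V \<Longrightarrow> ?r * norm (bary_grad V v) \<le> bary V v z"
      using inradius_pos by (simp add: sphere_subset_iff)
    have "(\<Sum>v\<in>V. bary V v z - ?r * norm (bary_grad V v)) = 1 - ?r * grad_sum"
      by (simp add: sum_subtractf sum_bary sum_distrib_left)
    also have "\<dots> = 0" using grad_sum_pos by (simp add: inradius_eq)
    finally have "\<forall>v\<in>V. bary V v z - ?r * norm (bary_grad V v) = 0"
      using le by (subst (asm) sum_nonneg_eq_0_iff) auto
    then show "\<forall>v\<in>V. bary V v z = ?r * norm (bary_grad V v)" by simp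
  qed (use inradius_pos in \<open>simp add: sphere_subset_iff\<close>)
  obtain z where z: "\<forall>v\<in>V. bary V v z = ?r * norm (bary_grad V v)"
    using ex_equidistant_point by (auto simp: inradius_eq)
  have unique: "x = z" if "\<forall>v\<in>V. bary V v x = ?r * norm (bary_grad V v)" for x
  proof -
    have "x = (\<Sum>v\<in>V. bary V v x *\<^sub>R v)" by (simp add: bary_expansion)
    also have "\<dots> = (\<Sum>v\<in>V. bary V v z *\<^sub>R v)" using that z by simp
    finally show ?thesis by (simp add: bary_expansion)
  qed
  have "incenter (convex hull V) = z"
    unfolding incenter_def iff by (rule the_equality, rule z, rule unique)
  with z assms show ?thesis by simp
qed

lemma bary_incenter_pos: "v \<in> V \<Longrightarrow> 0 < bary V v (incenter (convex hull V))"
  using inradius_pos bary_grad_nonzero by (simp add: bary_incenter)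

lemma incenter_mem: "incenter (convex hull V) \<in> convex hull V"
  using bary_incenter_pos by (force simp: mem_convex_hull_iff)

lemma inradius_grad_le_1:
  assumes "v \<in> V" shows "inradius (convex hull V) * norm (bary_grad V v) \<le> 1"
  using bary_le_1[OF incenter_mem assms] assms by (simp add: bary_incenter)

end

section \<open>Facets and the two sides of a facet\<close>

text \<open>
  For an affinely independent \<open>W\<close> and \<open>t > 0\<close> these are the points of its simplex that stay away from all its
  facets, measured in barycentric coordinates. The set refers to \<open>W\<close> only, so that for a common facet it
  is the same for both tetrahedra.
\<close>

definition deep_points :: "real \<Rightarrow> 'a::real_vector set \<Rightarrow> 'a set" where
  "deep_points t W = {\<Sum>w\<in>W. u w *\<^sub>R w | u. (\<forall>w\<in>W. t \<le> u w) \<and> sum u W = 1}"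

lemma convex_deep_points: "convex (deep_points t W)"
proof (rule convexI)
  fix x y :: 'a and a b :: real
  assume x: "x \<in> deep_points t W" and y: "y \<in> deep_points t W"
    and ab: "0 \<le> a" "0 \<le> b" "a + b = 1"
  obtain u where u: "\<forall>w\<in>W. t \<le> u w" "sum u W = 1" "x = (\<Sum>w\<in>W. u w *\<^sub>R w)"
    using x by (auto simp: deep_points_def)
  obtain u' where u': "\<forall>w\<in>W. t \<le> u' w" "sum u' W = 1" "y = (\<Sum>w\<in>W. u' w *\<^sub>R w)"
    using y by (auto simp: deep_points_def)
  have "t \<le> a * u w + b * u' w" if "w \<in> W" for w
  proof -
    have "a * t + b * t \<le> a * u w + b * u' w"
      using u(1) u'(1) that ab by (intro add_mono mult_left_mono) auto
    then show ?thesis using ab(3) by (metis distrib_right mult_1)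
  qed
  moreover have "(\<Sum>w\<in>W. a * u w + b * u' w) = 1"
    using u(2) u'(2) ab(3) by (simp add: sum.distrib flip: sum_distrib_left)
  moreover have "a *\<^sub>R x + b *\<^sub>R y = (\<Sum>w\<in>W. (a * u w + b * u' w) *\<^sub>R w)"
    by (simp add: u(3) u'(3) scaleR_sum_right scaleR_add_left sum.distrib)
  ultimately show "a *\<^sub>R x + b *\<^sub>R y \<in> deep_points t W"
    unfolding deep_points_def
    by (intro CollectI exI[of _ "\<lambda>w. a * u w + b * u' w"]) auto
qed

lemma deep_points_mono:
  assumes "t \<le> t'" shows "deep_points t' W \<subseteq> deep_points t W"
  using assms unfolding deep_points_def by (blast intro: order_trans)

lemma deep_points_subset_hull:
  assumes "finite W" "0 \<le> t" shows "deep_points t W \<subseteq> convex hull W"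
proof
  fix x assume "x \<in> deep_points t W"
  then obtain u where u: "\<forall>w\<in>W. t \<le> u w" "sum u W = 1" "x = (\<Sum>w\<in>W. u w *\<^sub>R w)"
    by (auto simp: deep_points_def)
  then show "x \<in> convex hull W"
    unfolding convex_hull_finite[OF assms(1)] using assms(2)
    by (intro CollectI exI[of _ u]) (auto intro: order_trans)
qed

lemma (in full_simplex) deep_points_facetI:
  assumes "d \<in> V" "bary V d x = 0" "\<And>w. w \<in> V - {d} \<Longrightarrow> t \<le> bary V w x"
  shows "x \<in> deep_points t (V - {d})"
proof -
  have "(\<Sum>w\<in>V - {d}. bary V w x) = 1"
    using sum_bary[of x] assms(1,2) by (simp add: sum.remove)
  moreover have "(\<Sum>w\<in>V - {d}. bary V w x *\<^sub>R w) = x"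
    using bary_expansion[of x] assms(1,2) by (simp add: sum.remove)
  ultimately show ?thesis
    unfolding deep_points_def using assms(3)
    by (auto intro!: exI[of _ "\<lambda>w. bary V w x"])
qed

lemma (in full_simplex) bary_facet:
  assumes "d \<in> V" "x \<in> convex hull (V - {d})" shows "bary V d x = 0"
proof -
  obtain u where u: "sum u (V - {d}) = 1" "x = (\<Sum>v\<in>V - {d}. u v *\<^sub>R v)"
    using assms(2) by (auto simp: convex_hull_finite)
  have "bary V d x = (\<Sum>v\<in>V - {d}. u v * bary V d v)"
    unfolding u(2) by (rule bary_affine_combination[OF u(1)])
  also have "\<dots> = 0" using assms(1) by (intro sum.neutral) (auto simp: bary_vertex)
  finally show ?thesis .
qed

lemma (in full_simplex) mem_facet_iff:
  assumes "d \<in> V"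
  shows "x \<in> convex hull (V - {d}) \<longleftrightarrow> x \<in> convex hull V \<and> bary V d x = 0"
proof
  assume "x \<in> convex hull (V - {d})"
  then show "x \<in> convex hull V \<and> bary V d x = 0"
    using bary_facet[OF assms] hull_mono[of "V - {d}" V] by auto
next
  assume "x \<in> convex hull V \<and> bary V d x = 0"
  then have "x \<in> deep_points 0 (V - {d})"
    using assms by (intro deep_points_facetI) (auto simp: bary_nonneg)
  then show "x \<in> convex hull (V - {d})"
    using deep_points_subset_hull[of "V - {d}" 0] by auto
qed

text \<open>
  Both sides are affine functions vanishing on the common facet, hence proportional; the factor is
  found by evaluating at the apex \<open>d\<close>. It is negative exactly when \<open>d\<close> and \<open>d'\<close> are on
  different sides of the facet.
\<close>

lemma (in full_simplex) bary_apex_expansion: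
  assumes "full_simplex V'" "d \<in> V" "d' \<in> V'" "V - {d} = V' - {d'}"
  shows "bary V' d' x = bary V d x * bary V' d' d"
proof -
  interpret V': full_simplex V' by fact
  have "bary V' d' x = bary V' d' (\<Sum>v\<in>V. bary V v x *\<^sub>R v)"
    by (simp add: bary_expansion)
  also have "\<dots> = (\<Sum>v\<in>V. bary V v x * bary V' d' v)"
    by (rule bary_affine_combination) (rule sum_bary)
  also have "\<dots> = bary V d x * bary V' d' d + (\<Sum>v\<in>V - {d}. bary V v x * bary V' d' v)"
    using assms(2) by (simp add: sum.remove)
  also have "(\<Sum>v\<in>V - {d}. bary V v x * bary V' d' v) = 0"
    unfolding assms(4) using assms(3) by (intro sum.neutral) (auto simp: V'.bary_vertex)
  finally show ?thesis by simp
qed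

text \<open>
  If both apices were on the same side, a point slightly off the centroid of the common facet towards
  \<open>d\<close> would belong to both simplices without lying on the facet.
\<close>

lemma (in full_simplex) opposite_sides:
  assumes "full_simplex V'" "d \<in> V" "d' \<in> V'" and W: "V - {d} = V' - {d'}"
    and meet: "convex hull V \<inter> convex hull V' = convex hull (V - {d})"
  shows "bary V' d' d < 0"
proof (rule ccontr)
  assume "\<not> ?thesis"
  moreover
  interpret V': full_simplex V' by fact
  have "bary V' d' d \<noteq> 0"
    using bary_apex_expansion[OF assms(1-4), of d'] by auto
  ultimately have pos: "0 < bary V' d' d" by simp
  \<comment> \<open>The weight \<open>e\<close> of \<open>d\<close> is so small that the coordinates \<open>1 / n\<close> of the centroid outweigh the
     possibly negative coordinates of \<open>d\<close> in the second simplex, which are bounded by \<open>B\<close>.\<close>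
  define W where "W = V - {d}"
  have W': "W = V' - {d'}" using W by (simp add: W_def)
  have finW: "finite W" by (simp add: W_def)
  define n where "n = real (card W)"
  define B where "B = (\<Sum>w\<in>W. \<bar>bary V' w d\<bar>)"
  define e where "e = 1 / (1 + n * B)"
  have "W \<noteq> {}" using ex_other_vertex[of d] by (auto simp: W_def)
  then have n: "0 < n" using finW by (simp add: n_def card_gt_0_iff)
  have B: "0 \<le> B" by (simp add: B_def sum_nonneg)
  have nB: "0 < 1 + n * B" using n B by (simp add: add_pos_nonneg)
  have e: "0 < e" "e \<le> 1" using n B nB by (auto simp: e_def)
  have "e * (1 + n * B) = 1" using nB by (simp add: e_def)
  then have "1 - e = n * (e * B)" by (simp add: algebra_simps)
  then have eB: "(1 - e) / n = e * B" using n by simp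
  define c where "c = (\<Sum>w\<in>W. (1 / n) *\<^sub>R w)"
  have sum1: "(\<Sum>w\<in>W. 1 / n) = 1" using n by (simp add: n_def)
  have c: "c \<in> convex hull W"
    unfolding convex_hull_finite[OF finW] c_def using sum1 n
    by (intro CollectI exI[of _ "\<lambda>_. 1 / n"]) auto
  define q where "q = (1 - e) *\<^sub>R c + e *\<^sub>R d"
  have "c \<in> convex hull V" using c hull_mono[of W V] by (auto simp: W_def)
  then have "q \<in> convex hull V"
    unfolding q_def using e assms(2) by (intro convexD) (auto simp: hull_inc)
  moreover have "q \<in> convex hull V'"
    unfolding V'.mem_convex_hull_iff
  proof
    fix v assume v: "v \<in> V'"
    have bq: "bary V' v q = (1 - e) * bary V' v c + e * bary V' v d"
      unfolding q_def by (rule bary_affine_combination_2) simp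
    show "0 \<le> bary V' v q"
    proof (cases "v = d'")
      case True
      have "bary V' d' c = 0"
        using V'.bary_facet[OF assms(3), of c] c by (simp add: W')
      then show ?thesis using bq pos e True by simp
    next
      case False
      then have vW: "v \<in> W" using v by (simp add: W')
      have "bary V' v c = (\<Sum>w\<in>W. 1 / n * of_bool (w = v))"
        unfolding c_def bary_affine_combination[OF sum1] using v
        by (intro sum.cong) (auto simp: V'.bary_vertex W')
      also have "\<dots> = 1 / n" using vW finW by (simp flip: sum_divide_distrib)
      finally have "bary V' v q = e * (B + bary V' v d)"
        using bq eB by (simp add: algebra_simps)
      moreover have "\<bar>bary V' v d\<bar> \<le> B"
        unfolding B_def using member_le_sum[OF vW, of "\<lambda>w. \<bar>bary V' w d\<bar>"] finW by auto
      ultimately show ?thesis using e by simp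
    qed
  qed
  ultimately have "q \<in> convex hull (V - {d})" using meet by auto
  then have "bary V d q = 0" by (rule bary_facet[OF assms(2)])
  moreover have "bary V d q = (1 - e) * bary V d c + e * bary V d d"
    unfolding q_def by (rule bary_affine_combination_2) simp
  moreover have "bary V d c = 0" using bary_facet[OF assms(2)] c by (simp add: W_def)
  ultimately show False using e by simp
qed

section \<open>Where the segment between two incenters crosses the common facet\<close>

context tetrahedron
begin

text \<open>The point at which the inscribed sphere touches the facet opposite to \<open>d\<close>.\<close>

definition tangent_point :: "real^3 \<Rightarrow> real^3" where
  "tangent_point d = incenter (convex hull V)
     - (inradius (convex hull V) / norm (bary_grad V d)) *\<^sub>R bary_grad V d"

text \<open>
  Let \<open>n\<^sub>v\<close> be the inner unit normal of the facet opposite to \<open>v\<close>. The coordinate at \<open>w\<close> of the touching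
  point is \<open>r |g\<^sub>w| (1 - n\<^sub>w \<bullet> n\<^sub>d)\<close>, so the two normals must be shown to be apart. Along the edge from \<open>w\<close>
  to \<open>d\<close>, of length at most \<open>h\<close>, the functional \<open>n\<^sub>d - n\<^sub>w\<close> grows by the sum of the heights over the two
  facets, and each height is at least \<open>r\<close>.
\<close>

lemma tangent_point_deep:
  assumes d: "d \<in> V"
  shows "tangent_point d \<in>
    deep_points (2 * (inradius (convex hull V) / diameter (convex hull V)) ^ 3) (V - {d})"
proof (rule deep_points_facetI[OF d])
  define r where "r = inradius (convex hull V)"
  define h where "h = diameter (convex hull V)"
  define g where "g = bary_grad V"
  define z where "z = incenter (convex hull V)"
  have r: "0 < r" and h: "0 < h" using inradius_pos diameter_pos by (auto simp: r_def h_def)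
  have g0: "0 < norm (g v)" if "v \<in> V" for v using bary_grad_nonzero[OF that] by (simp add: g_def)
  have bz: "bary V v z = r * norm (g v)" if "v \<in> V" for v
    using bary_incenter[OF that] by (simp add: z_def r_def g_def)
  have bp: "bary V v (tangent_point d) = r * norm (g v) - r / norm (g d) * (g v \<bullet> g d)"
    if "v \<in> V" for v
    using bary_add[of V v z "- (r / norm (g d)) *\<^sub>R g d"] bz[OF that]
    by (simp add: tangent_point_def r_def g_def z_def)
  show "bary V d (tangent_point d) = 0"
    using g0[OF d] by (simp add: bp[OF d] dot_square_norm power2_eq_square)
  fix w assume "w \<in> V - {d}"
  then have w: "w \<in> V" "w \<noteq> d" by auto
  \<comment> \<open>For unit vectors, \<open>1 - nw \<bullet> nd\<close> is half the square of \<open>norm (nd - nw)\<close>.\<close>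
  define nd where "nd = g d /\<^sub>R norm (g d)"
  define nw where "nw = g w /\<^sub>R norm (g w)"
  have unit: "nd \<bullet> nd = 1" "nw \<bullet> nw = 1"
    using g0[OF d] g0[OF w(1)] by (simp_all add: nd_def nw_def dot_square_norm power2_eq_square)
  have inv: "r \<le> 1 / norm (g v)" if "v \<in> V" for v
    using inradius_grad_le_1[OF that] g0[OF that] by (simp add: r_def g_def field_simps)
  have "g d \<bullet> (d - w) = 1" "g w \<bullet> (d - w) = - 1"
    using bary_diff[of V d d w] bary_diff[of V w d w] w d by (auto simp: g_def bary_vertex)
  then have "(nd - nw) \<bullet> (d - w) = 1 / norm (g d) + 1 / norm (g w)"
    by (simp add: nd_def nw_def inner_diff_left divide_inverse)
  then have "2 * r \<le> (nd - nw) \<bullet> (d - w)" using inv[OF d] inv[OF w(1)] by simp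
  also have "\<dots> \<le> norm (nd - nw) * norm (d - w)" by (rule norm_cauchy_schwarz)
  also have "\<dots> \<le> norm (nd - nw) * h"
    using diameter_bounded_bound[OF bounded_hull, of d w] d w
    by (intro mult_left_mono) (auto simp: h_def dist_norm hull_inc)
  finally have "2 * r / h \<le> norm (nd - nw)" using h by (simp add: pos_divide_le_eq)
  then have "(2 * r / h)\<^sup>2 \<le> (norm (nd - nw))\<^sup>2" using r h by (intro power_mono) auto
  also have "\<dots> = 2 - 2 * (nw \<bullet> nd)"
    using unit by (simp add: power2_norm_eq_inner inner_diff_left inner_diff_right inner_commute)
  finally have angle: "2 * (r / h)\<^sup>2 \<le> 1 - nw \<bullet> nd" by (simp add: power_divide power_mult_distrib)
  have "1 / h \<le> norm (g w)"
    using one_le_grad_diameter[OF w(1)] h by (simp add: g_def h_def pos_divide_le_eq)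
  then have "r / h \<le> r * norm (g w)" using r mult_left_mono[of "1 / h" "norm (g w)" r] by simp
  then have "r / h * (2 * (r / h)\<^sup>2) \<le> r * norm (g w) * (1 - nw \<bullet> nd)"
    using angle r h g0[OF w(1)] by (intro mult_mono) auto
  also have "r * norm (g w) * (1 - nw \<bullet> nd) = bary V w (tangent_point d)"
    using g0[OF w(1)] g0[OF d] by (simp add: bp[OF w(1)] nw_def nd_def field_simps)
  finally show "2 * (inradius (convex hull V) / diameter (convex hull V)) ^ 3
      \<le> bary V w (tangent_point d)"
    by (simp add: r_def h_def power3_eq_cube power2_eq_square mult_ac)
qed

text \<open>
  The weights \<open>r'\<close> and \<open>r\<close> of the two incenters make their offsets from the facet, \<open>r n\<close> and \<open>- r' n\<close>,
  cancel; the two touching points remain, with the same weights.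
\<close>

lemma incenter_segment_meets_facet:
  assumes "tetrahedron V'" and d: "d \<in> V" and d': "d' \<in> V'" and W: "V - {d} = V' - {d'}"
    and opp: "bary V' d' d < 0"
    and t: "t \<le> 2 * (inradius (convex hull V) / diameter (convex hull V)) ^ 3"
           "t \<le> 2 * (inradius (convex hull V') / diameter (convex hull V')) ^ 3"
  shows "\<exists>m \<in> deep_points t (V - {d}).
           m \<in> closed_segment (incenter (convex hull V)) (incenter (convex hull V'))"
proof -
  interpret V': tetrahedron V' by fact
  define r where "r = inradius (convex hull V)"
  define r' where "r' = inradius (convex hull V')"
  define z where "z = incenter (convex hull V)"
  define z' where "z' = incenter (convex hull V')"
  define n where "n = (1 / norm (bary_grad V d)) *\<^sub>R bary_grad V d"
  define p where "p = tangent_point d"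
  define p' where "p' = V'.tangent_point d'"
  define k where "k = bary V' d' d"
  have r: "0 < r" "0 < r'" using inradius_pos V'.inradius_pos by (auto simp: r_def r'_def)
  have "bary_grad V' d' \<bullet> x = (k *\<^sub>R bary_grad V d) \<bullet> x" for x
    using bary_apex_expansion[OF V'.full_simplex_axioms d d' W, of x]
      bary_apex_expansion[OF V'.full_simplex_axioms d d' W, of 0]
      bary_diff[of V' d' x 0] bary_diff[of V d x 0] by (simp add: k_def algebra_simps)
  then have grad': "bary_grad V' d' = k *\<^sub>R bary_grad V d" by (metis vector_eq_rdot)
  have k: "k < 0" using opp by (simp add: k_def)
  have zp: "z = p + r *\<^sub>R n" by (simp add: z_def p_def r_def n_def tangent_point_def)
  have zp': "z' = p' - r' *\<^sub>R n"
    using k by (simp add: z'_def p'_def r'_def n_def V'.tangent_point_def grad' field_simps)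
  have p: "p \<in> deep_points t (V - {d})"
    using tangent_point_deep[OF d] deep_points_mono[OF t(1)] by (auto simp: p_def)
  have p': "p' \<in> deep_points t (V - {d})"
    using V'.tangent_point_deep[OF d'] deep_points_mono[OF t(2)] by (auto simp: p'_def W)
  define a where "a = r' / (r + r')"
  define b where "b = r / (r + r')"
  have ab: "0 \<le> a" "0 \<le> b" "a + b = 1"
    using r by (auto simp: a_def b_def simp flip: add_divide_distrib)
  have "a * r = b * r'" by (simp add: a_def b_def)
  then have eq: "a *\<^sub>R z + b *\<^sub>R z' = a *\<^sub>R p + b *\<^sub>R p'"
    unfolding zp zp' by (simp add: algebra_simps)
  have "a *\<^sub>R p + b *\<^sub>R p' \<in> deep_points t (V - {d})"
    using convexD[OF convex_deep_points p p' ab] .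
  moreover have "a *\<^sub>R z + b *\<^sub>R z' \<in> closed_segment z z'"
    unfolding closed_segment_def using ab by (auto intro!: exI[of _ b])
  ultimately show ?thesis unfolding eq z_def[symmetric] z'_def[symmetric] by blast
qed

text \<open>
  The coordinate at \<open>d\<close> vanishes on the facet but has opposite signs at the two incenters, so along
  the segment it has a single zero.
\<close>

lemma incenter_segment_facet_unique:
  assumes "tetrahedron V'" and d: "d \<in> V" and d': "d' \<in> V'" and W: "V - {d} = V' - {d'}"
    and opp: "bary V' d' d < 0"
    and x: "x \<in> convex hull (V - {d})"
           "x \<in> closed_segment (incenter (convex hull V)) (incenter (convex hull V'))"
    and y: "y \<in> convex hull (V - {d})"
           "y \<in> closed_segment (incenter (convex hull V)) (incenter (convex hull V'))"
  shows "x = y"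
proof -
  interpret V': tetrahedron V' by fact
  define z where "z = incenter (convex hull V)"
  define z' where "z' = incenter (convex hull V')"
  obtain a where a: "x = (1 - a) *\<^sub>R z + a *\<^sub>R z'"
    using x(2) by (auto simp: closed_segment_def z_def z'_def)
  obtain b where b: "y = (1 - b) *\<^sub>R z + b *\<^sub>R z'"
    using y(2) by (auto simp: closed_segment_def z_def z'_def)
  have pos: "0 < bary V d z" using bary_incenter_pos[OF d] by (simp add: z_def)
  have "0 < bary V d z' * bary V' d' d"
    using V'.bary_incenter_pos[OF d']
      bary_apex_expansion[OF V'.full_simplex_axioms d d' W, of z'] by (simp add: z'_def)
  then have neg: "bary V d z' < 0" using opp by (simp add: zero_less_mult_iff)
  have "(1 - a) * bary V d z + a * bary V d z' = 0"
    using bary_facet[OF d x(1)] bary_affine_combination_2[of "1 - a" a V d z z'] by (simp add: a)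
  moreover have "(1 - b) * bary V d z + b * bary V d z' = 0"
    using bary_facet[OF d y(1)] bary_affine_combination_2[of "1 - b" b V d z z'] by (simp add: b)
  ultimately have "(a - b) * (bary V d z' - bary V d z) = 0" by (simp add: algebra_simps)
  then show ?thesis using pos neg a b by auto
qed

end

section \<open>A ball inside a subtetrahedron\<close>

text \<open>
  The supremum in \<open>inradius\<close> is over a bounded set, since antipodal points of a sphere inside \<open>K\<close> are no
  farther apart than the diameter of \<open>K\<close>.
\<close>

lemma le_inradiusI:
  assumes "bounded K" "0 \<le> e" "sphere w e \<subseteq> K"
  shows "e \<le> inradius K"
  unfolding inradius_def
proof (rule cSup_upper)
  show "e \<in> {r. 0 \<le> r \<and> (\<exists>z. sphere z r \<subseteq> K)}" using assms by auto
  show "bdd_above {r. 0 \<le> r \<and> (\<exists>z. sphere z r \<subseteq> K)}"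
  proof (rule bdd_aboveI[where M = "diameter K"])
    fix r assume "r \<in> {r. 0 \<le> r \<and> (\<exists>z. sphere z r \<subseteq> K)}"
    then obtain z where r: "0 \<le> r" and z: "sphere z r \<subseteq> K" by auto
    obtain e :: "real^3" where e: "norm e = 1" using vector_choose_size[of 1] by auto
    have "z + r *\<^sub>R e \<in> K" "z - r *\<^sub>R e \<in> K" using z r e by (auto simp: dist_norm)
    then have "dist (z + r *\<^sub>R e) (z - r *\<^sub>R e) \<le> diameter K"
      by (rule diameter_bounded_bound[OF assms(1)])
    moreover have "dist (z + r *\<^sub>R e) (z - r *\<^sub>R e) = 2 * r"
      using r e by (simp add: dist_norm flip: scaleR_2)
    ultimately show "r \<le> diameter K" using r by simp
  qed
qed

lemma convex_combination_4:
  assumes "convex C" "a \<in> C" "b \<in> C" "c \<in> C" "d \<in> C"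
    and "0 \<le> \<alpha>" "0 \<le> \<beta>" "0 \<le> \<gamma>" "0 \<le> \<delta>" "\<alpha> + \<beta> + \<gamma> + \<delta> = 1"
  shows "\<alpha> *\<^sub>R a + \<beta> *\<^sub>R b + \<gamma> *\<^sub>R c + \<delta> *\<^sub>R d \<in> C"
proof -
  have "(\<Sum>i<4. ([\<alpha>, \<beta>, \<gamma>, \<delta>] ! i) *\<^sub>R ([a, b, c, d] ! i)) \<in> C"
    using assms by (intro convex_sum) (auto simp: numeral_eq_Suc less_Suc_eq)
  then show ?thesis by (simp add: numeral_eq_Suc)
qed

text \<open>
  A step of length \<open>r / (4 M)\<close> changes each barycentric coordinate in \<open>V\<close> by at most \<open>1 / (4 M)\<close>. The
  coordinates with respect to \<open>a, b, m, z\<close> are obtained from these by solving a triangular linear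
  system with pivots \<open>bary V d z \<ge> s\<close> and the coordinate of \<open>m\<close> at \<open>c\<close>, which is at least \<open>t\<close>. So they
  change by at most \<open>1/4\<close>, and \<open>1/4\<close> is their common value at the centroid.
\<close>

lemma (in tetrahedron) subtetrahedron_contains_sphere:
  assumes V: "V = {a, b, c, d}" and distinct: "distinct [a, b, c, d]"
    and m: "m \<in> deep_points t {a, b, c}" and t: "0 < t"
    and z: "z \<in> convex hull V" "s \<le> bary V d z" and s: "0 < s"
    and M: "M = (1 + 1 / s) * (1 + 1 / t)"
  shows "sphere ((1/4) *\<^sub>R (a + b + m + z)) (inradius (convex hull V) / (4 * M))
           \<subseteq> convex hull {a, b, m, z}"
proof
  define r where "r = inradius (convex hull V)"
  define w where "w = (1/4) *\<^sub>R (a + b + m + z)"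
  have r: "0 < r" using inradius_pos by (simp add: r_def)
  have Mpos: "0 < M" using s t by (simp add: M add_pos_pos)
  fix x assume "x \<in> sphere ((1/4) *\<^sub>R (a + b + m + z)) (inradius (convex hull V) / (4 * M))"
  then have x: "norm (x - w) = r / (4 * M)"
    by (simp add: dist_norm w_def r_def norm_minus_commute)
  obtain u where "\<forall>w\<in>{a, b, c}. t \<le> u w" and usum: "sum u {a, b, c} = 1"
    and um: "m = (\<Sum>w\<in>{a, b, c}. u w *\<^sub>R w)"
    using m by (auto simp: deep_points_def)
  then have ut: "t \<le> u a" "t \<le> u b" "t \<le> u c" by auto
  have u1: "u a + u b + u c = 1" and mu: "m = u a *\<^sub>R a + u b *\<^sub>R b + u c *\<^sub>R c"
    using usum um distinct by auto
  define y where "y = (\<lambda>v. bary V v z)"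
  have y0: "0 \<le> y a" "0 \<le> y b" "0 \<le> y c" "s \<le> y d"
    using bary_nonneg[OF z(1)] z(2) V by (auto simp: y_def)
  have y1: "y a + y b + y c + y d = 1" and zy: "z = y a *\<^sub>R a + y b *\<^sub>R b + y c *\<^sub>R c + y d *\<^sub>R d"
    using sum_bary[of z] bary_expansion[of z] distinct
    by (simp_all add: y_def V add.assoc)
  \<comment> \<open>\<open>D\<close> is the change of the coordinates in \<open>V\<close>; \<open>\<alpha>\<close>, \<open>\<beta>\<close>, \<open>\<gamma>\<close>, \<open>\<delta>\<close> below are the changes of those
     with respect to \<open>a\<close>, \<open>b\<close>, \<open>m\<close>, \<open>z\<close>.\<close>
  define D where "D = (\<lambda>v. bary V v x - bary V v w)"
  have "(\<Sum>v\<in>V. D v) = 0" "(\<Sum>v\<in>V. D v *\<^sub>R v) = x - w"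
    by (simp_all add: D_def sum_subtractf scaleR_diff_left sum_bary bary_expansion)
  then have D0: "D a + D b + D c + D d = 0"
    and xw: "x - w = D a *\<^sub>R a + D b *\<^sub>R b + D c *\<^sub>R c + D d *\<^sub>R d"
    using distinct by (simp_all add: V add.assoc)
  define e where "e = 1 / (4 * M)"
  have e: "0 < e" using Mpos by (simp add: e_def)
  have De: "\<bar>D v\<bar> \<le> e" if "v \<in> V" for v
  proof -
    have "\<bar>D v\<bar> \<le> norm (bary_grad V v) * norm (x - w)"
      unfolding D_def bary_diff by (rule Cauchy_Schwarz_ineq2)
    also have "\<dots> = (r * norm (bary_grad V v)) * e" by (simp add: x e_def)
    also have "\<dots> \<le> 1 * e"
      using inradius_grad_le_1[OF that] e by (intro mult_right_mono) (auto simp: r_def)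
    finally show ?thesis by simp
  qed
  define \<delta> where "\<delta> = D d / y d"
  define \<gamma> where "\<gamma> = (D c - \<delta> * y c) / u c"
  define \<alpha> where "\<alpha> = D a - \<gamma> * u a - \<delta> * y a"
  define \<beta> where "\<beta> = D b - \<gamma> * u b - \<delta> * y b"
  have Dd: "D d = \<delta> * y d" using y0 s by (simp add: \<delta>_def)
  have Dc: "D c = \<gamma> * u c + \<delta> * y c" using ut t by (simp add: \<gamma>_def)
  have total: "\<alpha> + \<beta> + \<gamma> + \<delta> = 0"
  proof -
    have "\<alpha> + \<beta> + \<gamma> * (u a + u b + u c) + \<delta> * (y a + y b + y c + y d) = 0"
      using D0 Dd Dc by (simp add: \<alpha>_def \<beta>_def algebra_simps)
    then show ?thesis by (simp add: u1 y1)
  qed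
  have xw': "x - w = \<alpha> *\<^sub>R a + \<beta> *\<^sub>R b + \<gamma> *\<^sub>R m + \<delta> *\<^sub>R z"
    unfolding xw Dd Dc mu zy \<alpha>_def \<beta>_def by (simp add: algebra_simps)
  have d_le: "\<bar>\<delta>\<bar> \<le> e / s"
    unfolding \<delta>_def abs_divide using De[of d] y0 s by (intro frac_le) (auto simp: V)
  have c_le: "\<bar>\<gamma>\<bar> \<le> e * (1 + 1 / s) / t"
  proof -
    have "\<bar>\<delta> * y c\<bar> \<le> e / s * 1"
      unfolding abs_mult using d_le y0 y1 s by (intro mult_mono) auto
    then have "\<bar>D c - \<delta> * y c\<bar> \<le> e * (1 + 1 / s)"
      using De[of c] by (simp add: V algebra_simps)
    then show ?thesis
      unfolding \<gamma>_def abs_divide using ut t by (intro frac_le) auto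
  qed
  have "e + e / s + e * (1 + 1 / s) / t = e * M"
    by (simp add: M algebra_simps add_divide_distrib)
  also have "\<dots> = 1 / 4" using Mpos by (simp add: e_def)
  finally have total_le: "e + e / s + e * (1 + 1 / s) / t = 1 / 4" .
  have ab_le: "\<bar>D v - \<gamma> * u v - \<delta> * y v\<bar> \<le> 1 / 4" if "v \<in> V" "\<bar>u v\<bar> \<le> 1" "\<bar>y v\<bar> \<le> 1" for v
  proof -
    have "\<bar>\<gamma> * u v\<bar> \<le> e * (1 + 1 / s) / t * 1"
      unfolding abs_mult using c_le that by (intro mult_mono) auto
    moreover have "\<bar>\<delta> * y v\<bar> \<le> e / s * 1"
      unfolding abs_mult using d_le that s e by (intro mult_mono) auto
    ultimately show ?thesis using De[OF that(1)] total_le by linarith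
  qed
  have "0 \<le> e / s" "0 \<le> e * (1 + 1 / s) / t" using e s t by auto
  then have "\<bar>\<gamma>\<bar> \<le> 1/4" "\<bar>\<delta>\<bar> \<le> 1/4"
    using c_le d_le total_le e by linarith+
  moreover have "\<bar>\<alpha>\<bar> \<le> 1/4" "\<bar>\<beta>\<bar> \<le> 1/4"
    using ab_le[of a] ab_le[of b] ut t u1 y0 s y1 by (auto simp: V \<alpha>_def \<beta>_def)
  ultimately have small: "0 \<le> 1/4 + \<alpha>" "0 \<le> 1/4 + \<beta>" "0 \<le> 1/4 + \<gamma>" "0 \<le> 1/4 + \<delta>"
    by linarith+
  have "w + (\<alpha> *\<^sub>R a + \<beta> *\<^sub>R b + \<gamma> *\<^sub>R m + \<delta> *\<^sub>R z)
      = (1/4 + \<alpha>) *\<^sub>R a + (1/4 + \<beta>) *\<^sub>R b + (1/4 + \<gamma>) *\<^sub>R m + (1/4 + \<delta>) *\<^sub>R z"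
    unfolding w_def by (simp add: algebra_simps)
  also have "\<dots> \<in> convex hull {a, b, m, z}"
    using small total by (intro convex_combination_4) (auto simp: hull_inc)
  finally show "x \<in> convex hull {a, b, m, z}" by (simp flip: xw')
qed

section \<open>Tetrahedral meshes and their split points\<close>

lemma (in full_simplex) facet_of_hullE:
  assumes "F facet_of convex hull V"
  obtains d where "d \<in> V" "F = convex hull (V - {d})" "{v. v extreme_point_of F} = V - {d}"
proof -
  obtain d where d: "d \<in> V" "F = convex hull (V - {d})"
    using assms by (auto simp: facet_of_convex_hull_affine_independent[OF indep])
  have "\<not> affine_dependent (V - {d})" using indep by (rule affine_independent_Diff)
  then have "{v. v extreme_point_of F} = V - {d}"
    using d(2) by (auto simp: extreme_point_of_convex_hull_affine_independent)
  with d that show ?thesis by blast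
qed

locale mesh =
  fixes \<T> :: "(real^3) set set"
  assumes tetrahedral_mesh: "tetrahedral_mesh \<T>"
begin

lemma finite_mesh: "finite \<T>" and nonempty_mesh: "\<T> \<noteq> {}"
  using tetrahedral_mesh by (auto simp: tetrahedral_mesh_def triangulation_def)

lemma elementE:
  assumes "T \<in> \<T>" obtains V where "tetrahedron V" "T = convex hull V"
proof -
  have "3 simplex T" using assms tetrahedral_mesh by (auto simp: tetrahedral_mesh_def)
  then obtain V where V: "\<not> affine_dependent V" "int (card V) = 3 + 1" "T = convex hull V"
    by (auto simp: simplex_def)
  from V(2) have "card V = Suc DIM(real^3)" by simp
  with V that show ?thesis by (metis full_simplex.intro tetrahedron.intro)
qed

lemma aff_dim_element: "T \<in> \<T> \<Longrightarrow> aff_dim T = 3"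
  using tetrahedral_mesh by (auto simp: tetrahedral_mesh_def aff_dim_simplex)

lemma convex_element: "T \<in> \<T> \<Longrightarrow> convex T"
  by (metis elementE convex_convex_hull)

lemma meet_face: "T \<in> \<T> \<Longrightarrow> T' \<in> \<T> \<Longrightarrow> T \<inter> T' face_of T"
  using tetrahedral_mesh by (auto simp: tetrahedral_mesh_def triangulation_def)

text \<open>
  The intersection is a face of \<open>T\<close> containing \<open>F\<close>, so by dimension it is \<open>F\<close> or \<open>T\<close>; in the second case
  it would equally be \<open>T'\<close>.
\<close>

lemma meet_eq_facet:
  assumes T: "T \<in> \<T>" and T': "T' \<in> \<T>" and "T \<noteq> T'"
    and F: "F facet_of T" "F facet_of T'"
  shows "T \<inter> T' = F"
proof (rule ccontr)
  assume neq: "T \<inter> T' \<noteq> F"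
  have sub: "F \<subseteq> T \<inter> T'" using F by (simp add: facet_of_imp_subset)
  have "F face_of T \<inter> T'"
    by (rule face_of_subset[OF _ sub]) (use F(1) in \<open>auto simp: facet_of_def\<close>)
  then have "aff_dim F < aff_dim (T \<inter> T')"
    using face_of_aff_dim_lt[OF convex_Int[OF convex_element[OF T] convex_element[OF T']]] neq
    by blast
  moreover have "aff_dim F = 2" using F(1) aff_dim_element[OF T] by (simp add: facet_of_def)
  ultimately have dim: "3 \<le> aff_dim (T \<inter> T')" by simp
  have "T \<inter> T' = T"
  proof (rule ccontr)
    assume "T \<inter> T' \<noteq> T"
    from face_of_aff_dim_lt[OF convex_element[OF T] meet_face[OF T T'] this]
    show False using dim aff_dim_element[OF T] by simp
  qed
  moreover have "T' \<inter> T = T'"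
  proof (rule ccontr)
    assume "T' \<inter> T \<noteq> T'"
    from face_of_aff_dim_lt[OF convex_element[OF T'] meet_face[OF T' T] this]
    show False using dim aff_dim_element[OF T'] by (simp add: Int_commute)
  qed
  ultimately show False using \<open>T \<noteq> T'\<close> by auto
qed

lemma facetE:
  assumes "T \<in> \<T>" "F facet_of T"
  obtains V d where "tetrahedron V" "T = convex hull V" "d \<in> V"
    "F = convex hull (V - {d})" "{v. v extreme_point_of F} = V - {d}"
proof -
  obtain V where V: "tetrahedron V" "T = convex hull V" using elementE[OF assms(1)] .
  interpret V: tetrahedron V by fact
  obtain d where "d \<in> V" "F = convex hull (V - {d})" "{v. v extreme_point_of F} = V - {d}"
    using V.facet_of_hullE assms(2) unfolding V(2) .
  then show ?thesis using that[OF V] by blast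
qed

lemma apices_opposite:
  assumes "T \<in> \<T>" "T' \<in> \<T>" "T \<noteq> T'" "F facet_of T" "F facet_of T'"
    and V: "tetrahedron V" "T = convex hull V" "d \<in> V" "F = convex hull (V - {d})"
    and V': "tetrahedron V'" "T' = convex hull V'" "d' \<in> V'" "V - {d} = V' - {d'}"
  shows "bary V' d' d < 0"
proof -
  interpret V: tetrahedron V by fact
  interpret V': tetrahedron V' by fact
  have "convex hull V \<inter> convex hull V' = convex hull (V - {d})"
    using meet_eq_facet[OF assms(1-5)] V(2,4) V'(2) by simp
  then show ?thesis
    by (rule V.opposite_sides[OF V'.full_simplex_axioms V(3) V'(3,4)])
qed

text \<open>
  Of three elements on one facet two would be on the same side: by \<open>bary_apex_expansion\<close> the sign
  relating the first apex to the third is the product of two negative signs.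
\<close>

lemma at_most_two_elements:
  assumes T: "T1 \<in> \<T>" "T2 \<in> \<T>" "T3 \<in> \<T>"
    and F: "F facet_of T1" "F facet_of T2" "F facet_of T3"
    and "T1 \<noteq> T2"
  shows "T3 = T1 \<or> T3 = T2"
proof (rule ccontr)
  assume "\<not> ?thesis"
  then have ne: "T1 \<noteq> T3" "T2 \<noteq> T3" by auto
  obtain V1 d1 where V1: "tetrahedron V1" "T1 = convex hull V1" "d1 \<in> V1"
    "F = convex hull (V1 - {d1})" "{v. v extreme_point_of F} = V1 - {d1}"
    using facetE[OF T(1) F(1)] .
  obtain V2 d2 where V2: "tetrahedron V2" "T2 = convex hull V2" "d2 \<in> V2"
    "F = convex hull (V2 - {d2})" "{v. v extreme_point_of F} = V2 - {d2}"
    using facetE[OF T(2) F(2)] .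
  obtain V3 d3 where V3: "tetrahedron V3" "T3 = convex hull V3" "d3 \<in> V3"
    "F = convex hull (V3 - {d3})" "{v. v extreme_point_of F} = V3 - {d3}"
    using facetE[OF T(3) F(3)] .
  interpret V2: tetrahedron V2 by fact
  interpret V3: tetrahedron V3 by fact
  have W: "V1 - {d1} = V2 - {d2}" "V1 - {d1} = V3 - {d3}" "V2 - {d2} = V3 - {d3}"
    using V1(5) V2(5) V3(5) by simp_all
  have 12: "bary V2 d2 d1 < 0"
    by (rule apices_opposite[OF T(1,2) \<open>T1 \<noteq> T2\<close> F(1,2) V1(1-4) V2(1-3) W(1)])
  have 23: "bary V3 d3 d2 < 0"
    by (rule apices_opposite[OF T(2,3) ne(2) F(2,3) V2(1-4) V3(1-3) W(3)])
  have 13: "bary V3 d3 d1 < 0"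
    by (rule apices_opposite[OF T(1,3) ne(1) F(1,3) V1(1-4) V3(1-3) W(2)])
  have "bary V3 d3 d1 = bary V2 d2 d1 * bary V3 d3 d2"
    by (rule V2.bary_apex_expansion[OF V3.full_simplex_axioms V2(3) V3(3) W(3)])
  with 13 mult_neg_neg[OF 12 23] show False by linarith
qed

text \<open>
  For an interior face the pair of elements whose intersection is \<open>F\<close> is unique up to order, so the
  definite description in \<open>split_point\<close> concerns one segment only, and that segment meets \<open>F\<close> in exactly one
  point.
\<close>

lemma split_point_deep:
  assumes T: "T \<in> \<T>" and F: "F facet_of T"
    and t: "0 \<le> t" "t \<le> 1 / 3" "\<And>T. T \<in> \<T> \<Longrightarrow> t \<le> 2 * (inradius T / diameter T) ^ 3"
  shows "split_point \<T> F \<in> deep_points t {v. v extreme_point_of F}"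
proof (cases "interior_face \<T> F")
  case False
  let ?W = "{v. v extreme_point_of F}"
  obtain V d where V: "tetrahedron V" and d: "d \<in> V" "?W = V - {d}"
    using facetE[OF T F] by metis
  interpret V: tetrahedron V by fact
  have "card ?W = 3" using V.card_V d by (simp add: card_Diff_singleton)
  then have "sum (\<lambda>_. 1 / 3) ?W = (1 :: real)" by simp
  moreover have "split_point \<T> F = (\<Sum>v\<in>?W. (1/3) *\<^sub>R v)"
    using False by (simp add: split_point_def triangle_barycenter_def scaleR_sum_right)
  ultimately show ?thesis
    unfolding deep_points_def using t(2) by (intro CollectI exI[of _ "\<lambda>_. 1 / 3"]) auto
next
  case True
  then obtain T1 T2 where T12: "T1 \<in> \<T>" "T2 \<in> \<T>" "T1 \<noteq> T2" "F = T1 \<inter> T2"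
    "F facet_of T1" "F facet_of T2" by (auto simp: interior_face_def)
  let ?W = "{v. v extreme_point_of F}"
  let ?S = "closed_segment (incenter T1) (incenter T2)"
  obtain V d where V: "tetrahedron V" "T1 = convex hull V" "d \<in> V"
    "F = convex hull (V - {d})" "?W = V - {d}"
    using facetE[OF T12(1,5)] .
  obtain V' d' where V': "tetrahedron V'" "T2 = convex hull V'" "d' \<in> V'"
    "F = convex hull (V' - {d'})" "?W = V' - {d'}"
    using facetE[OF T12(2,6)] .
  interpret V: tetrahedron V by fact
  have W: "V - {d} = V' - {d'}" using V(5) V'(5) by simp
  have opp: "bary V' d' d < 0"
    by (rule apices_opposite[OF T12(1,2,3,5,6) V(1-4) V'(1-3) W])
  obtain m where m: "m \<in> deep_points t ?W" "m \<in> ?S"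
    using V.incenter_segment_meets_facet[OF V'(1) V(3) V'(3) W opp, of t] t(3) T12(1,2)
    unfolding V(2)[symmetric] V'(2)[symmetric] V(5)[symmetric] by blast
  have "m \<in> deep_points t (V - {d})" using m(1) unfolding V(5) .
  then have mF: "m \<in> F"
    using deep_points_subset_hull[of "V - {d}" t] t(1) by (auto simp: V(4))
  have unique: "m' = m" if "m' \<in> F" "m' \<in> ?S" for m'
    using V.incenter_segment_facet_unique[OF V'(1) V(3) V'(3) W opp, of m' m] that mF m(2)
    unfolding V(2)[symmetric] V'(2)[symmetric] V(4)[symmetric] by blast
  have pair: "closed_segment (incenter T1') (incenter T2') = ?S"
    if T': "T1' \<in> \<T>" "T2' \<in> \<T>" "T1' \<noteq> T2'" "F = T1' \<inter> T2'" for T1' T2'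
  proof -
    have dim: "F \<noteq> {}" "aff_dim F = 2"
      using T12 aff_dim_element[OF T12(1)] by (auto simp: facet_of_def)
    have facets: "F facet_of T1'" "F facet_of T2'"
      using meet_face[OF T'(1,2)] meet_face[OF T'(2,1)] dim T' aff_dim_element
      by (auto simp: facet_of_def Int_commute)
    have "T1' = T1 \<or> T1' = T2" "T2' = T1 \<or> T2' = T2"
      using at_most_two_elements[OF T12(1,2) _ T12(5,6) _ T12(3)] T' facets by blast+
    then show ?thesis using T'(3) by (auto simp: closed_segment_commute)
  qed
  have "split_point \<T> F = m"
    unfolding split_point_def if_P[OF True]
  proof (rule the_equality)
    show "\<exists>T1\<in>\<T>. \<exists>T2\<in>\<T>. T1 \<noteq> T2 \<and> F = T1 \<inter> T2 \<and>
        m \<in> F \<inter> closed_segment (incenter T1) (incenter T2)"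
      using T12 mF m(2) by blast
  next
    fix m' assume "\<exists>T1\<in>\<T>. \<exists>T2\<in>\<T>. T1 \<noteq> T2 \<and> F = T1 \<inter> T2 \<and>
        m' \<in> F \<inter> closed_segment (incenter T1) (incenter T2)"
    then show "m' = m" using pair unique by blast
  qed
  with m(1) show ?thesis by simp
qed

lemma finite_worsey_farin: "finite (worsey_farin \<T>)"
proof -
  define E where "E T = {v :: real^3. v extreme_point_of T}" for T
  define f where "f = (\<lambda>T (a, b, F). convex hull {a, b, split_point \<T> F, incenter T})"
  have "finite (f T ` (E T \<times> E T \<times> {F. F face_of T}))" if T: "T \<in> \<T>" for T
  proof -
    obtain V where V: "tetrahedron V" "T = convex hull V" using elementE[OF T] .
    interpret V: tetrahedron V by fact
    have "E T = V"
      using V(2) V.indep by (simp add: E_def extreme_point_of_convex_hull_affine_independent)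
    moreover have "polytope T" using V.finite_V unfolding polytope_def V(2) by blast
    ultimately show ?thesis using V.finite_V finite_polytope_faces[of T] by simp
  qed
  moreover have "worsey_farin \<T> \<subseteq> (\<Union>T\<in>\<T>. f T ` (E T \<times> E T \<times> {F. F face_of T}))"
  proof
    fix K assume "K \<in> worsey_farin \<T>"
    then obtain a b F T where *: "T \<in> \<T>" "F facet_of T" "closed_segment a b edge_of F"
      "K = convex hull {a, b, split_point \<T> F, incenter T}"
      by (auto simp: worsey_farin_def)
    have "F face_of T" using *(2) by (simp add: facet_of_def)
    moreover then have "closed_segment a b face_of T"
      using *(3) face_of_trans by (auto simp: edge_of_def)
    then have "a \<in> E T" "b \<in> E T" by (auto simp: E_def dest: segment_face_of)
    ultimately show "K \<in> (\<Union>T\<in>\<T>. f T ` (E T \<times> E T \<times> {F. F face_of T}))"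
      using *(1,4) by (intro UN_I[of T] image_eqI[of _ _ "(a, b, F)"]) (auto simp: f_def)
  qed
  ultimately show ?thesis using finite_mesh by (meson finite_UN_I finite_subset)
qed

lemma worsey_farin_nonempty: "worsey_farin \<T> \<noteq> {}"
proof -
  obtain T where T: "T \<in> \<T>" using nonempty_mesh by blast
  obtain V where V: "tetrahedron V" "T = convex hull V" using elementE[OF T] .
  interpret V: tetrahedron V by fact
  obtain d where d: "d \<in> V" using V.V_nonempty by blast
  have "card (V - {d}) = 3" using V.card_V d by (simp add: card_Diff_singleton)
  then obtain a b c where abc: "V - {d} = {a, b, c}" "a \<noteq> b" by (auto simp: card_3_iff)
  have "convex hull (V - {d}) facet_of T"
    unfolding V(2) facet_of_convex_hull_affine_independent[OF V.indep] using d abc(1)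
    by (metis convex_hull_eq_empty insert_not_empty)
  moreover have "closed_segment a b edge_of convex hull (V - {d})"
    unfolding edge_of_def
  proof
    have "\<not> affine_dependent (V - {d})" using V.indep by (rule affine_independent_Diff)
    then show "closed_segment a b face_of convex hull (V - {d})"
      unfolding segment_convex_hull using abc(1)
      by (subst face_of_convex_hull_affine_independent) (auto intro!: exI[of _ "{a, b}"])
    show "aff_dim (closed_segment a b) = 1"
      unfolding segment_convex_hull aff_dim_convex_hull using abc(2) by (simp add: aff_dim_2)
  qed
  ultimately show ?thesis using T unfolding worsey_farin_def by blast
qed

section \<open>Shape regularity of the Worsey-Farin refinement\<close>

text \<open>
  The factors come from \<open>h / r \<le> 2 c\<close> and from the radius \<open>r / (4 M)\<close> of the ball inside \<open>K\<close>, where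
  \<open>M = (1 + 1/s) (1 + 1/t)\<close> with \<open>1/s = 2 c\<close> and \<open>1/t = 3 + 4 c\<^sup>3\<close>.
\<close>

lemma shape_ratio_subtetrahedron:
  assumes K: "K \<in> worsey_farin \<T>" and c: "\<And>T. T \<in> \<T> \<Longrightarrow> shape_ratio T \<le> c"
  shows "shape_ratio K \<le> 4 * c * (1 + 2 * c) * (4 + 4 * c ^ 3)"
proof -
  obtain a b F T where *: "T \<in> \<T>" "F facet_of T" "closed_segment a b edge_of F"
    "K = convex hull {a, b, split_point \<T> F, incenter T}"
    using K by (auto simp: worsey_farin_def)
  obtain V d where V: "tetrahedron V" "T = convex hull V"
    and d: "d \<in> V" "F = convex hull (V - {d})" "{v. v extreme_point_of F} = V - {d}"
    using facetE[OF *(1,2)] .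
  interpret V: tetrahedron V by fact
  have pos: "0 < inradius T" "0 < diameter T" if T: "T \<in> \<T>" for T
  proof -
    obtain U where U: "tetrahedron U" "T = convex hull U" using elementE[OF T] .
    interpret U: tetrahedron U by fact
    show "0 < inradius T" "0 < diameter T"
      using U.inradius_pos U.diameter_pos U(2) by simp_all
  qed
  have c_pos: "0 < c"
  proof -
    have "0 < shape_ratio T" using pos[OF *(1)] by (simp add: shape_ratio_def)
    then show ?thesis using c[OF *(1)] by simp
  qed
  \<comment> \<open>This \<open>t\<close> is below both \<open>1/3\<close>, needed for barycenters, and \<open>2 * s ^ 3 = 1 / (4 * c ^ 3)\<close>, needed
     for touching points.\<close>
  define s where "s = 1 / (2 * c)"
  define t where "t = 1 / (3 + 4 * c ^ 3)"
  have s: "0 < s" and t: "0 < t" using c_pos by (auto simp: s_def t_def add_pos_pos)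
  have s_le: "s \<le> inradius T / diameter T" if "T \<in> \<T>" for T
    using c[OF that] pos[OF that] c_pos
    by (simp add: s_def shape_ratio_def field_simps)
  have "t \<le> 2 * s ^ 3"
  proof -
    have "t \<le> 1 / (4 * c ^ 3)" unfolding t_def using c_pos by (intro frac_le) auto
    then show ?thesis by (simp add: s_def power_divide power_mult_distrib)
  qed
  then have t_le: "t \<le> 2 * (inradius T / diameter T) ^ 3" if "T \<in> \<T>" for T
    using power_mono[OF s_le[OF that], of 3] s by simp
  have "t \<le> 1 / 3" unfolding t_def using c_pos by (intro frac_le) auto
  then have m: "split_point \<T> F \<in> deep_points t {v. v extreme_point_of F}"
    using t t_le by (intro split_point_deep[OF *(1,2)]) auto
  have ab: "a \<in> V - {d}" "b \<in> V - {d}" "a \<noteq> b"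
    using *(3) segment_face_of[of a b F] unfolding d(3)[symmetric] by (auto simp: edge_of_def)
  have "card (V - {d} - {a} - {b}) = 1" using V.card_V d ab by (simp add: card_Diff_singleton)
  then obtain e where e: "V - {d} - {a} - {b} = {e}" by (auto simp: card_1_singleton_iff)
  have W: "V - {d} = {a, b, e}" and V_eq: "V = {a, b, e, d}" and dist: "distinct [a, b, e, d]"
    using e ab d(1) by auto
  define r where "r = inradius T"
  define h where "h = diameter T"
  define M where "M = (1 + 1 / s) * (1 + 1 / t)"
  have M: "0 < M" using s t by (simp add: M_def add_pos_pos)
  have r: "0 < r" and h: "0 < h" using pos[OF *(1)] by (auto simp: r_def h_def)
  have rh: "s \<le> r / h" using s_le[OF *(1)] by (simp add: r_def h_def)
  have "1 / h \<le> norm (bary_grad V d)"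
    using V.one_le_grad_diameter[OF d(1)] h V(2) by (simp add: h_def pos_divide_le_eq)
  then have "r / h \<le> bary V d (incenter T)"
    using V.bary_incenter[OF d(1)] V(2) r mult_left_mono[of "1 / h" "norm (bary_grad V d)" r]
    by (simp add: r_def)
  with rh have z: "s \<le> bary V d (incenter T)" by simp
  have "sphere ((1/4) *\<^sub>R (a + b + split_point \<T> F + incenter T)) (r / (4 * M)) \<subseteq> K"
    unfolding *(4) r_def V(2)
    using m d(3) W t s z V.incenter_mem V(2)
    by (intro V.subtetrahedron_contains_sphere[OF V_eq dist _ t _ _ s M_def]) auto
  moreover have "bounded K" unfolding *(4)
    by (intro bounded_convex_hull finite_imp_bounded) auto
  ultimately have inr: "r / (4 * M) \<le> inradius K" using r M by (intro le_inradiusI) auto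
  have "split_point \<T> F \<in> convex hull (V - {d})"
    using m d(3) t deep_points_subset_hull[of "V - {d}" t] by auto
  then have "split_point \<T> F \<in> T" using d(1) V(2) V.mem_facet_iff by auto
  then have "K \<subseteq> T"
    unfolding *(4) using V.incenter_mem V(2) ab
    by (intro hull_minimal) (auto simp: hull_inc)
  then have "diameter K \<le> h"
    unfolding h_def using V.bounded_hull V(2) by (intro diameter_subset) auto
  then have "shape_ratio K \<le> h / (2 * (r / (4 * M)))"
    unfolding shape_ratio_def using inr r M h by (intro frac_le) auto
  also have "\<dots> = 4 * M * (h / (2 * r))" using r M by (simp add: field_simps)
  also have "\<dots> \<le> 4 * M * c"
    using c[OF *(1)] M by (intro mult_left_mono) (auto simp: shape_ratio_def h_def r_def)
  also have "M = (1 + 2 * c) * (4 + 4 * c ^ 3)"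
    by (simp add: M_def s_def t_def)
  finally show ?thesis by (simp only: mult_ac)
qed

end

theorem theorem3p1:
  shows "\<exists>C :: real \<Rightarrow> real. (\<forall>c. 0 < C c) \<and>
           (\<forall>\<T> :: (real^3) set set. tetrahedral_mesh \<T> \<longrightarrow>
              shape_regularity (worsey_farin \<T>) \<le> C (shape_regularity \<T>))"
proof -
  define B where "B c = 4 * c * (1 + 2 * c) * (4 + 4 * c ^ 3)" for c :: real
  have "shape_regularity (worsey_farin \<T>) \<le> max 1 (B (shape_regularity \<T>))"
    if "tetrahedral_mesh \<T>" for \<T> :: "(real^3) set set"
  proof -
    interpret mesh \<T> by standard fact
    have "shape_ratio T \<le> shape_regularity \<T>" if "T \<in> \<T>" for T
      unfolding shape_regularity_def using finite_mesh that by (intro Max_ge) auto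
    then have "shape_ratio K \<le> B (shape_regularity \<T>)" if "K \<in> worsey_farin \<T>" for K
      using shape_ratio_subtetrahedron[OF that] by (simp add: B_def)
    then have "shape_regularity (worsey_farin \<T>) \<le> B (shape_regularity \<T>)"
      unfolding shape_regularity_def[of "worsey_farin \<T>"]
      using finite_worsey_farin worsey_farin_nonempty by (intro Max.boundedI) auto
    then show ?thesis by simp
  qed
  \<comment> \<open>The maximum with 1 makes the bound positive also at nonpositive arguments.\<close>
  then show ?thesis by (intro exI[of _ "\<lambda>c. max 1 (B c)"]) auto
qed

end
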